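(* Let $\Gamma=(N,A,\mathcal F,\Xi(A),u)$ and $\Gamma'=(N,B,\mathcal G,\Xi(B),v)$ be two strategic form games with finitely additive strategies, with the same player set $N$. For each $i\in N$ let $\varphi_i\colon A_i\to B_i$ be a surjective map that is measurable, i.e. $\varphi_i^{-1}(G_i)\in\mathcal F_i$ for every $G_i\in\mathcal G_i$, and suppose that $\varphi\colon A\to B$, $\varphi(a)=(\varphi_i(a_i))_{i\in N}$, respects payoffs: $u_i(a)=v_i(\varphi(a))$ for all $a\in A$ and $i\in N$. Let $\Phi\colon\Xi(A)\to\Xi(B)$ be given by $\Phi(\kappa)=(\Phi_i(\kappa_i))_{i\in N}$, where $\Phi_i(\kappa_i)(G_i)=\kappa_i(\varphi_i^{-1}(G_i))$ for $G_i\in\mathcal G_i$. If $\kappa\in\Xi(A)$ is a perfect equilibrium of $\Gamma$, then $\Phi(\kappa)$ is a perfect equilibrium of $\Gamma'$.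
   Context: A directed set $(I,\le)$ is a non-empty set with a reflexive, transitive relation such that every pair has an upper bound and there is no maximal element (for every $\alpha$ there is $\beta\ge\alpha$ with $\beta\neq\alpha$). Nets are indexed by directed sets; convergence is as usual. A field on a set $X$ is a collection of subsets containing $\emptyset$ and closed under complements and finite unions. A charge on a field is a finitely additive $[0,1]$-valued set function with total mass $1$. A strategic form game with finitely additive strategies $\Gamma=(N,A,\mathcal F,\Xi,u)$ consists of: $N=\{1,\dots,n\}$; $A=\prod_{i\in N}A_i$ with each $A_i$ non-empty; $\mathcal F=(\mathcal F_i)_{i\in N}$ with $\mathcal F_i$ a field on $A_i$ containing all singletons; $\Xi=\Xi(A)=\prod_i\Xi_i$, where $\Xi_i$ is the set of all charges on $\mathcal F_i$; and bounded functions $u_i\colon A\to\mathbb R$, each of which is a uniform limit of simple functions. A rectangle is a set $R=\prod_iR_i$ with $R_i\in\mathcal F_i$, and $\kappa(R)=\prod_i\kappa_i(R_i)$ for $\kappa\in\Xi$; a simple function is a finite sum $f=\sum_\ell c_\ell\mathbb I_{R^\ell}$ with $R^\ell$ rectangles and $c_\ell\in\mathbb R$, and $\kappa(f)=\sum_\ell c_\ell\kappa(R^\ell)$. The payoff function $U_i\colon\Xi\to\mathbb R$ is the expected payoff $U_i(\kappa)=\sup\{\kappa(f)\mid f\text{ simple},f\le u_i\}=\inf\{\kappa(g)\mid g\text{ simple},g\ge u_i\}$ (these agree for uniform limits of simple functions). $\Xi$ has the Tychonov topology: the smallest topology containing all sets $\{\tau\in\Xi\mid|\kappa(R^k)-\tau(R^k)|<\varepsilon,\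 k=1,\dots,\ell\}$ with $\kappa\in\Xi$, $\varepsilon>0$ and rectangles $R^1,\dots,R^\ell$. Likewise for $\Gamma'$. $(\tau_i\mid\sigma)$ is the profile $\sigma$ with $\sigma_i$ replaced by $\tau_i$. $\tau_i\in\Xi_i$ is a best response to $\sigma\in\Xi$ if $U_i(\tau_i\mid\sigma)\ge U_i(\tau_i'\mid\sigma)$ for all $\tau_i'\in\Xi_i$; a profile $\tau$ is a best response to $\sigma$ if each $\tau_i$ is. $\sigma$ is a Nash equilibrium if it is a best response to itself. The carrier of $\sigma_i\in\Xi_i$ is $\mathcal C_i(\sigma_i)=\{E\in\mathcal F_i\mid\sigma_i(E)>0\}$, and $\mathcal C(\sigma)=\prod_i\mathcal C_i(\sigma_i)$. A carrier is a set of the form $\mathcal C(\sigma)$ with $\sigma\in\Xi$. A net $(\sigma_\alpha)_{\alpha\in I}$ in $\Xi$ is completely mixed if for every carrier $\mathcal C$ there is $\alpha\in I$ with $\mathcal C\subseteq\mathcal C(\sigma_\beta)$ for all $\beta\ge\alpha$. $\sigma$ is perfect if there are a completely mixed net $(\sigma_\alpha)_{\alpha\in I}$ and a net $(\kappa_\alpha)_{\alpha\in I}$ in $\Xi$, both converging to $\sigma$, such that $\kappa_\alpha$ is a best response to $\sigma_\alpha$ for each $\alpha\in I$. A perfect equilibrium is a Nash equilibrium that is perfect. *)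

theory Defs
  imports "HOL-Analysis.Analysis"
begin

section \<open>Nets\<close>

definition directed_set :: "'i set \<Rightarrow> ('i \<Rightarrow> 'i \<Rightarrow> bool) \<Rightarrow> bool" where
  "directed_set I le \<longleftrightarrow>
     I \<noteq> {} \<and> reflp_on I le \<and> transp_on I le \<and>
     (\<forall>\<alpha>\<in>I. \<forall>\<beta>\<in>I. \<exists>\<gamma>\<in>I. le \<alpha> \<gamma> \<and> le \<beta> \<gamma>) \<and>
     (\<forall>\<alpha>\<in>I. \<exists>\<beta>\<in>I. le \<alpha> \<beta> \<and> \<beta> \<noteq> \<alpha>)"

definition net_filter :: "'i set \<Rightarrow> ('i \<Rightarrow> 'i \<Rightarrow> bool) \<Rightarrow> 'i filter" where
  "net_filter I le = (INF \<alpha>\<in>I. principal {\<beta>\<in>I. le \<alpha> \<beta>})"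

lemma eventually_net_filter:
  assumes "directed_set I le"
  shows "eventually P (net_filter I le) \<longleftrightarrow> (\<exists>\<alpha>\<in>I. \<forall>\<beta>\<in>I. le \<alpha> \<beta> \<longrightarrow> P \<beta>)"
proof -
  have ne: "I \<noteq> {}" and tr: "transp_on I le"
    and ub: "\<And>a b. a \<in> I \<Longrightarrow> b \<in> I \<Longrightarrow> \<exists>c\<in>I. le a c \<and> le b c"
    using assms unfolding directed_set_def by blast+
  have "\<exists>c\<in>I. principal {\<beta>\<in>I. le c \<beta>} \<le> inf (principal {\<beta>\<in>I. le a \<beta>}) (principal {\<beta>\<in>I. le b \<beta>})"
    if ab: "a \<in> I" "b \<in> I" for a b
  proof -
    obtain c where c: "c \<in> I" "le a c" "le b c" using ub[OF ab] by blast
    have "{\<beta>\<in>I. le c \<beta>} \<subseteq> {\<beta>\<in>I. le a \<beta>} \<inter> {\<beta>\<in>I. le b \<beta>}"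
      using c ab transp_onD[OF tr] by blast
    then show ?thesis using c(1) by auto
  qed
  then have "eventually P (net_filter I le) \<longleftrightarrow>
      (\<exists>\<alpha>\<in>I. eventually P (principal {\<beta>\<in>I. le \<alpha> \<beta>}))"
    unfolding net_filter_def using ne by (intro eventually_INF_base) auto
  then show ?thesis by (auto simp: eventually_principal)
qed

text \<open>
  HOL cannot quantify existentially over types, so the existence of a net with values in
  \<open>'x\<close>, indexed by some directed set, is expressed with the index type below.  This is no
  restriction: by \<open>reindex_net\<close>, every net over an arbitrary index type can be replaced by one
  over this type with the same values and the same tail behaviour.
\<close>

type_synonym 'x net_index = "'x set \<times> 'x \<times> nat"

lemma reindex_net:
  fixes I :: "'i set" and x :: "'i \<Rightarrow> 'x"
  assumes dir: "directed_set I le"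
  obtains J :: "'x net_index set" and le' and y where
    "directed_set J le'" "y ` J = x ` I"
    "\<And>P. (\<exists>\<alpha>\<in>J. \<forall>\<beta>\<in>J. le' \<alpha> \<beta> \<longrightarrow> P (y \<beta>)) \<longleftrightarrow> (\<exists>\<alpha>\<in>I. \<forall>\<beta>\<in>I. le \<alpha> \<beta> \<longrightarrow> P (x \<beta>))"
proof -
  define T where "T \<alpha> = x ` {\<beta>\<in>I. le \<alpha> \<beta>}" for \<alpha>
  define J :: "'x net_index set" where "J = {(S, z, k). S \<in> T ` I \<and> z \<in> S}"
  define le' :: "'x net_index \<Rightarrow> 'x net_index \<Rightarrow> bool" where
    "le' = (\<lambda>(S, z, k) (S', z', k'). S' \<subseteq> S \<and> k \<le> k')"
  define y :: "'x net_index \<Rightarrow> 'x" where "y = (\<lambda>(S, z, k). z)"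
  have ne: "I \<noteq> {}" and rf: "\<And>a. a \<in> I \<Longrightarrow> le a a" and tr: "transp_on I le"
    and ub: "\<And>a b. a \<in> I \<Longrightarrow> b \<in> I \<Longrightarrow> \<exists>c\<in>I. le a c \<and> le b c"
    using dir unfolding directed_set_def reflp_on_def by blast+
  have xT: "x \<alpha> \<in> T \<alpha>" if "\<alpha> \<in> I" for \<alpha>
    using that rf unfolding T_def by auto
  have Tmono: "T \<beta> \<subseteq> T \<alpha>" if "\<alpha> \<in> I" "\<beta> \<in> I" "le \<alpha> \<beta>" for \<alpha> \<beta>
    using that transp_onD[OF tr] unfolding T_def by blast
  have inJ: "(T \<alpha>, x \<alpha>, k) \<in> J" if "\<alpha> \<in> I" for \<alpha> k
    using that xT unfolding J_def by auto
  have "directed_set J le'"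
    unfolding directed_set_def
  proof (intro conjI ballI)
    show "J \<noteq> {}" using ne inJ by blast
    show "reflp_on J le'" "transp_on J le'"
      by (auto simp: reflp_on_def transp_on_def le'_def)
  next
    fix p q assume "p \<in> J" "q \<in> J"
    then obtain a b z w k l where p: "p = (T a, z, k)" "a \<in> I" and q: "q = (T b, w, l)" "b \<in> I"
      unfolding J_def by auto
    obtain c where c: "c \<in> I" "le a c" "le b c" using ub p q by blast
    have "le' p (T c, x c, max k l) \<and> le' q (T c, x c, max k l)"
      using Tmono c p q by (auto simp: le'_def)
    then show "\<exists>r\<in>J. le' p r \<and> le' q r" using inJ[OF c(1)] by blast
  next
    fix p assume "p \<in> J"
    then obtain S z k where p: "p = (S, z, k)" "S \<in> T ` I" "z \<in> S" unfolding J_def by auto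
    then show "\<exists>q\<in>J. le' p q \<and> q \<noteq> p"
      by (intro bexI[of _ "(S, z, Suc k)"]) (auto simp: le'_def J_def)
  qed
  moreover have "y ` J = x ` I"
  proof
    show "y ` J \<subseteq> x ` I" by (auto simp: y_def J_def T_def)
    show "x ` I \<subseteq> y ` J"
    proof
      fix z assume "z \<in> x ` I"
      then obtain a where "a \<in> I" "z = x a" by blast
      then show "z \<in> y ` J"
        using inJ[of a 0] by (auto simp: y_def intro: image_eqI[rotated])
    qed
  qed
  moreover have "(\<exists>\<alpha>\<in>J. \<forall>\<beta>\<in>J. le' \<alpha> \<beta> \<longrightarrow> P (y \<beta>)) \<longleftrightarrow>
      (\<exists>\<alpha>\<in>I. \<forall>\<beta>\<in>I. le \<alpha> \<beta> \<longrightarrow> P (x \<beta>))" for P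
  proof
    assume "\<exists>\<alpha>\<in>J. \<forall>\<beta>\<in>J. le' \<alpha> \<beta> \<longrightarrow> P (y \<beta>)"
    then obtain p where p: "p \<in> J" "\<And>q. q \<in> J \<Longrightarrow> le' p q \<Longrightarrow> P (y q)" by blast
    then obtain a z k where a: "p = (T a, z, k)" "a \<in> I" unfolding J_def by auto
    have "P (x b)" if "b \<in> I" "le a b" for b
      using p(2)[of "(T b, x b, k)"] inJ[OF that(1)] Tmono[OF a(2) that] a
      by (auto simp: le'_def y_def)
    then show "\<exists>\<alpha>\<in>I. \<forall>\<beta>\<in>I. le \<alpha> \<beta> \<longrightarrow> P (x \<beta>)" using a by blast
  next
    assume "\<exists>\<alpha>\<in>I. \<forall>\<beta>\<in>I. le \<alpha> \<beta> \<longrightarrow> P (x \<beta>)"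
    then obtain a where a: "a \<in> I" "\<And>b. b \<in> I \<Longrightarrow> le a b \<Longrightarrow> P (x b)" by blast
    have "P (y q)" if "q \<in> J" "le' (T a, x a, 0) q" for q
      using that a(2) by (auto simp: le'_def y_def J_def T_def subset_iff)
    then show "\<exists>\<alpha>\<in>J. \<forall>\<beta>\<in>J. le' \<alpha> \<beta> \<longrightarrow> P (y \<beta>)" using inJ[OF a(1)] by blast
  qed
  ultimately show ?thesis by (rule that)
qed

section \<open>Charges and games\<close>

text \<open>
  Charges are extensional: they are \<open>undefined\<close> outside the field, so that a charge is
  determined by its values on the field.
\<close>

definition charges :: "'a set \<Rightarrow> 'a set set \<Rightarrow> ('a set \<Rightarrow> real) set" where
  "charges \<Omega> M = {\<mu> \<in> M \<rightarrow>\<^sub>E {0..1}. additive M \<mu> \<and> \<mu> \<Omega> = 1}"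

text \<open>
  All action sets \<open>A\<^sub>i\<close> live in one type; replacing that type by a sum type
  shows that this is no restriction.
\<close>

record 'a game =
  num_players :: nat
  actions :: "nat \<Rightarrow> 'a set"
  events :: "nat \<Rightarrow> 'a set set"
  util :: "nat \<Rightarrow> (nat \<Rightarrow> 'a) \<Rightarrow> real"

type_synonym 'a profile = "nat \<Rightarrow> 'a set \<Rightarrow> real"

definition players :: "'a game \<Rightarrow> nat set" where
  "players \<Gamma> = {1..num_players \<Gamma>}"

definition pure_profiles :: "'a game \<Rightarrow> (nat \<Rightarrow> 'a) set" where
  "pure_profiles \<Gamma> = (\<Pi>\<^sub>E i\<in>players \<Gamma>. actions \<Gamma> i)"

definition strategies :: "'a game \<Rightarrow> nat \<Rightarrow> ('a set \<Rightarrow> real) set" where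
  "strategies \<Gamma> i = charges (actions \<Gamma> i) (events \<Gamma> i)"

definition profiles :: "'a game \<Rightarrow> 'a profile set" where
  "profiles \<Gamma> = (\<Pi>\<^sub>E i\<in>players \<Gamma>. strategies \<Gamma> i)"

text \<open>
  A rectangle is given by the family of its sides \<open>R\<^sub>i\<close>; the set itself is \<open>rect_set \<Gamma> R\<close>.
\<close>

definition rectangles :: "'a game \<Rightarrow> (nat \<Rightarrow> 'a set) set" where
  "rectangles \<Gamma> = (\<Pi>\<^sub>E i\<in>players \<Gamma>. events \<Gamma> i)"

definition rect_set :: "'a game \<Rightarrow> (nat \<Rightarrow> 'a set) \<Rightarrow> (nat \<Rightarrow> 'a) set" where
  "rect_set \<Gamma> R = (\<Pi>\<^sub>E i\<in>players \<Gamma>. R i)"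

definition rect_charge :: "'a game \<Rightarrow> 'a profile \<Rightarrow> (nat \<Rightarrow> 'a set) \<Rightarrow> real" where
  "rect_charge \<Gamma> \<kappa> R = (\<Prod>i\<in>players \<Gamma>. \<kappa> i (R i))"

text \<open>
  A simple function is given by a representation \<open>[(c\<^sub>1, R\<^sup>1), \<dots>, (c\<^sub>m, R\<^sup>m)]\<close>.
\<close>

definition simple_reps :: "'a game \<Rightarrow> (real \<times> (nat \<Rightarrow> 'a set)) list set" where
  "simple_reps \<Gamma> = lists (UNIV \<times> rectangles \<Gamma>)"

definition simple_fun :: "'a game \<Rightarrow> (real \<times> (nat \<Rightarrow> 'a set)) list \<Rightarrow> (nat \<Rightarrow> 'a) \<Rightarrow> real" where
  "simple_fun \<Gamma> s a = (\<Sum>(c, R)\<leftarrow>s. c * indicator (rect_set \<Gamma> R) a)"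

definition simple_integral :: "'a game \<Rightarrow> 'a profile \<Rightarrow> (real \<times> (nat \<Rightarrow> 'a set)) list \<Rightarrow> real" where
  "simple_integral \<Gamma> \<kappa> s = (\<Sum>(c, R)\<leftarrow>s. c * rect_charge \<Gamma> \<kappa> R)"

definition fa_game :: "'a game \<Rightarrow> bool" where
  "fa_game \<Gamma> \<longleftrightarrow>
     1 \<le> num_players \<Gamma> \<and>
     (\<forall>i\<in>players \<Gamma>.
        actions \<Gamma> i \<noteq> {} \<and>
        algebra (actions \<Gamma> i) (events \<Gamma> i) \<and>
        (\<forall>a\<in>actions \<Gamma> i. {a} \<in> events \<Gamma> i) \<and>
        bounded (util \<Gamma> i ` pure_profiles \<Gamma>) \<and>
        (\<exists>s. (\<forall>k. s k \<in> simple_reps \<Gamma>) \<and>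
             uniform_limit (pure_profiles \<Gamma>) (\<lambda>k. simple_fun \<Gamma> (s k)) (util \<Gamma> i) sequentially))"

text \<open>
  The expected payoff as lower integral; for uniform limits of simple functions, as required in
  \<open>fa_game\<close>, it coincides with the upper one.
\<close>

definition payoff :: "'a game \<Rightarrow> nat \<Rightarrow> 'a profile \<Rightarrow> real" where
  "payoff \<Gamma> i \<kappa> =
     Sup {simple_integral \<Gamma> \<kappa> s | s.
       s \<in> simple_reps \<Gamma> \<and> (\<forall>a\<in>pure_profiles \<Gamma>. simple_fun \<Gamma> s a \<le> util \<Gamma> i a)}"

definition profile_topology :: "'a game \<Rightarrow> 'a profile topology" where
  "profile_topology \<Gamma> = topology_generated_by
     {{\<tau> \<in> profiles \<Gamma>. \<forall>R\<in>\<R>. \<bar>rect_charge \<Gamma> \<kappa> R - rect_charge \<Gamma> \<tau> R\<bar> < \<epsilon>} | \<kappa> \<epsilon> \<R>.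
       \<kappa> \<in> profiles \<Gamma> \<and> 0 < \<epsilon> \<and> finite \<R> \<and> \<R> \<subseteq> rectangles \<Gamma>}"

section \<open>Equilibria\<close>

definition best_response_for :: "'a game \<Rightarrow> nat \<Rightarrow> ('a set \<Rightarrow> real) \<Rightarrow> 'a profile \<Rightarrow> bool" where
  "best_response_for \<Gamma> i \<rho> \<sigma> \<longleftrightarrow>
     \<rho> \<in> strategies \<Gamma> i \<and>
     (\<forall>\<rho>'\<in>strategies \<Gamma> i. payoff \<Gamma> i (\<sigma>(i := \<rho>)) \<ge> payoff \<Gamma> i (\<sigma>(i := \<rho>')))"

definition best_response :: "'a game \<Rightarrow> 'a profile \<Rightarrow> 'a profile \<Rightarrow> bool" where
  "best_response \<Gamma> \<tau> \<sigma> \<longleftrightarrow>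
     \<tau> \<in> profiles \<Gamma> \<and> (\<forall>i\<in>players \<Gamma>. best_response_for \<Gamma> i (\<tau> i) \<sigma>)"

definition nash_equilibrium :: "'a game \<Rightarrow> 'a profile \<Rightarrow> bool" where
  "nash_equilibrium \<Gamma> \<sigma> \<longleftrightarrow> \<sigma> \<in> profiles \<Gamma> \<and> best_response \<Gamma> \<sigma> \<sigma>"

definition carrier_of :: "'a game \<Rightarrow> 'a profile \<Rightarrow> (nat \<Rightarrow> 'a set) set" where
  "carrier_of \<Gamma> \<sigma> = (\<Pi>\<^sub>E i\<in>players \<Gamma>. {E \<in> events \<Gamma> i. \<sigma> i E > 0})"

definition carriers :: "'a game \<Rightarrow> (nat \<Rightarrow> 'a set) set set" where
  "carriers \<Gamma> = carrier_of \<Gamma> ` profiles \<Gamma>"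

definition completely_mixed ::
    "'a game \<Rightarrow> 'i set \<Rightarrow> ('i \<Rightarrow> 'i \<Rightarrow> bool) \<Rightarrow> ('i \<Rightarrow> 'a profile) \<Rightarrow> bool" where
  "completely_mixed \<Gamma> I le s \<longleftrightarrow>
     (\<forall>\<alpha>\<in>I. s \<alpha> \<in> profiles \<Gamma>) \<and>
     (\<forall>C\<in>carriers \<Gamma>. \<exists>\<alpha>\<in>I. \<forall>\<beta>\<in>I. le \<alpha> \<beta> \<longrightarrow> C \<subseteq> carrier_of \<Gamma> (s \<beta>))"

definition perfect_via ::
    "'i set \<Rightarrow> ('i \<Rightarrow> 'i \<Rightarrow> bool) \<Rightarrow> 'a game \<Rightarrow> 'a profile \<Rightarrow> bool" where
  "perfect_via I le \<Gamma> \<sigma> \<longleftrightarrow>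
     directed_set I le \<and>
     (\<exists>s k. completely_mixed \<Gamma> I le s \<and>
            (\<forall>\<alpha>\<in>I. k \<alpha> \<in> profiles \<Gamma>) \<and>
            limitin (profile_topology \<Gamma>) s \<sigma> (net_filter I le) \<and>
            limitin (profile_topology \<Gamma>) k \<sigma> (net_filter I le) \<and>
            (\<forall>\<alpha>\<in>I. best_response \<Gamma> (k \<alpha>) (s \<alpha>)))"

definition perfect :: "'a game \<Rightarrow> 'a profile \<Rightarrow> bool" where
  "perfect \<Gamma> \<sigma> \<longleftrightarrow>
     \<sigma> \<in> profiles \<Gamma> \<and>
     (\<exists>(I :: ('a profile \<times> 'a profile) net_index set) le. perfect_via I le \<Gamma> \<sigma>)"

text \<open>Nets over any other index type witness perfectness as well.\<close>

lemma perfect_viaD: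
  fixes I :: "'i set"
  assumes "\<sigma> \<in> profiles \<Gamma>" and "perfect_via I le \<Gamma> \<sigma>"
  shows "perfect \<Gamma> \<sigma>"
proof -
  from assms(2) obtain s k where dir: "directed_set I le"
    and cm: "completely_mixed \<Gamma> I le s"
    and kp: "\<forall>\<alpha>\<in>I. k \<alpha> \<in> profiles \<Gamma>"
    and ls: "limitin (profile_topology \<Gamma>) s \<sigma> (net_filter I le)"
    and lk: "limitin (profile_topology \<Gamma>) k \<sigma> (net_filter I le)"
    and br: "\<forall>\<alpha>\<in>I. best_response \<Gamma> (k \<alpha>) (s \<alpha>)"
    unfolding perfect_via_def by blast
  define x where "x \<alpha> = (s \<alpha>, k \<alpha>)" for \<alpha>
  obtain J :: "('a profile \<times> 'a profile) net_index set" and le' y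
    where dirJ: "directed_set J le'" and im: "y ` J = x ` I"
      and ev: "\<And>P. (\<exists>\<alpha>\<in>J. \<forall>\<beta>\<in>J. le' \<alpha> \<beta> \<longrightarrow> P (y \<beta>)) \<longleftrightarrow> (\<exists>\<alpha>\<in>I. \<forall>\<beta>\<in>I. le \<alpha> \<beta> \<longrightarrow> P (x \<beta>))"
    by (rule reindex_net[OF dir, of x]) (rule that)
  have all: "\<forall>\<alpha>\<in>J. P (y \<alpha>)" if P: "\<forall>\<alpha>\<in>I. P (x \<alpha>)" for P
  proof
    fix j assume "j \<in> J"
    then have "y j \<in> x ` I" unfolding im[symmetric] by (rule imageI)
    then show "P (y j)" using P by auto
  qed
  have carr: "(\<exists>\<alpha>\<in>J. \<forall>\<beta>\<in>J. le' \<alpha> \<beta> \<longrightarrow> C \<subseteq> carrier_of \<Gamma> (fst (y \<beta>))) \<longleftrightarrow>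
      (\<exists>\<alpha>\<in>I. \<forall>\<beta>\<in>I. le \<alpha> \<beta> \<longrightarrow> C \<subseteq> carrier_of \<Gamma> (s \<beta>))" for C
    using ev[of "\<lambda>p. C \<subseteq> carrier_of \<Gamma> (fst p)"] unfolding x_def fst_conv .
  have evs: "eventually (\<lambda>j. fst (y j) \<in> U) (net_filter J le') \<longleftrightarrow>
      eventually (\<lambda>\<alpha>. s \<alpha> \<in> U) (net_filter I le)" for U
    using ev[of "\<lambda>p. fst p \<in> U"]
    unfolding eventually_net_filter[OF dir] eventually_net_filter[OF dirJ] x_def fst_conv .
  have evk: "eventually (\<lambda>j. snd (y j) \<in> U) (net_filter J le') \<longleftrightarrow>
      eventually (\<lambda>\<alpha>. k \<alpha> \<in> U) (net_filter I le)" for U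
    using ev[of "\<lambda>p. snd p \<in> U"]
    unfolding eventually_net_filter[OF dir] eventually_net_filter[OF dirJ] x_def snd_conv .
  have "\<forall>j\<in>J. fst (y j) \<in> profiles \<Gamma>"
    using cm all[of "\<lambda>p. fst p \<in> profiles \<Gamma>"] by (simp add: completely_mixed_def x_def)
  then have "completely_mixed \<Gamma> J le' (\<lambda>j. fst (y j))"
    using cm unfolding completely_mixed_def carr by blast
  moreover have "\<forall>j\<in>J. snd (y j) \<in> profiles \<Gamma>"
    using kp all[of "\<lambda>p. snd p \<in> profiles \<Gamma>"] by (simp add: x_def)
  moreover have "limitin (profile_topology \<Gamma>) (\<lambda>j. fst (y j)) \<sigma> (net_filter J le')"
    using ls unfolding limitin_def evs .
  moreover have "limitin (profile_topology \<Gamma>) (\<lambda>j. snd (y j)) \<sigma> (net_filter J le')"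
    using lk unfolding limitin_def evk .
  moreover have "\<forall>j\<in>J. best_response \<Gamma> (snd (y j)) (fst (y j))"
    using br all[of "\<lambda>p. best_response \<Gamma> (snd p) (fst p)"] by (simp add: x_def)
  ultimately have "perfect_via J le' \<Gamma> \<sigma>"
    unfolding perfect_via_def using dirJ
    by (intro conjI exI[of _ "\<lambda>j. fst (y j)"] exI[of _ "\<lambda>j. snd (y j)"]) simp_all
  then show ?thesis unfolding perfect_def using assms(1) by blast
qed

definition perfect_equilibrium :: "'a game \<Rightarrow> 'a profile \<Rightarrow> bool" where
  "perfect_equilibrium \<Gamma> \<sigma> \<longleftrightarrow> nash_equilibrium \<Gamma> \<sigma> \<and> perfect \<Gamma> \<sigma>"

section \<open>Induced maps\<close>

definition pure_map :: "'a game \<Rightarrow> (nat \<Rightarrow> 'a \<Rightarrow> 'b) \<Rightarrow> (nat \<Rightarrow> 'a) \<Rightarrow> nat \<Rightarrow> 'b" where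
  "pure_map \<Gamma> \<phi> a = (\<lambda>i\<in>players \<Gamma>. \<phi> i (a i))"

definition push_charge ::
    "'a set \<Rightarrow> 'b set set \<Rightarrow> ('a \<Rightarrow> 'b) \<Rightarrow> ('a set \<Rightarrow> real) \<Rightarrow> 'b set \<Rightarrow> real" where
  "push_charge \<Omega> M f \<mu> = (\<lambda>G\<in>M. \<mu> (f -` G \<inter> \<Omega>))"

definition push_profile ::
    "'a game \<Rightarrow> 'b game \<Rightarrow> (nat \<Rightarrow> 'a \<Rightarrow> 'b) \<Rightarrow> 'a profile \<Rightarrow> 'b profile" where
  "push_profile \<Gamma> \<Gamma>' \<phi> \<kappa> =
     (\<lambda>i\<in>players \<Gamma>. push_charge (actions \<Gamma> i) (events \<Gamma>' i) (\<phi> i) (\<kappa> i))"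

end

theory Submission
  imports Defs
begin

text \<open>
  Pulling simple functions back along \<open>\<phi>\<close> shows that \<open>\<Phi>\<close> preserves payoffs: the payoffs of \<open>\<Gamma>'\<close> are
  uniformly approximated by simple functions from below and above, and the integral of simple
  functions is monotone.  Moreover \<open>\<Phi>\<close> is surjective: a charge on \<open>\<G>\<^sub>i\<close> extends to all subsets of
  \<open>B\<^sub>i\<close>, because finitely many of its values are matched by a charge with finite support and
  \<open>[0,1]\<close> to the power set is compact; the extension is then moved to \<open>A\<^sub>i\<close> by a section of \<open>\<phi>\<^sub>i\<close>.
  Surjectivity means that every deviation and every carrier in \<open>\<Gamma>'\<close> comes from \<open>\<Gamma>\<close> and that
  \<open>\<Phi>\<close> is continuous, so \<open>\<Phi>\<close> carries the nets witnessing perfectness of \<open>\<kappa>\<close> to nets witnessing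
  perfectness of \<open>\<Phi>(\<kappa>)\<close>.
\<close>

section \<open>Integrating simple functions against charges\<close>

lemma additive_empty:
  fixes \<mu> :: "'a set \<Rightarrow> real"
  assumes "algebra \<Omega> M" "additive M \<mu>"
  shows "\<mu> {} = 0"
proof -
  interpret algebra \<Omega> M by fact
  have "\<mu> ({} \<union> {}) = \<mu> {} + \<mu> {}"
    using assms(2) by (intro additiveD) auto
  then show ?thesis by simp
qed

lemma additive_split:
  fixes \<mu> :: "'a set \<Rightarrow> real"
  assumes "algebra \<Omega> M" "additive M \<mu>" "E \<in> M" "F \<in> M"
  shows "\<mu> E = \<mu> (E \<inter> F) + \<mu> (E - F)"
proof -
  interpret algebra \<Omega> M by fact
  have "\<mu> ((E \<inter> F) \<union> (E - F)) = \<mu> (E \<inter> F) + \<mu> (E - F)"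
    using assms by (intro additiveD[of M]) auto
  moreover have "(E \<inter> F) \<union> (E - F) = E" by auto
  ultimately show ?thesis by simp
qed

text \<open>Induction on \<open>s\<close>, cutting \<open>E\<close> along the first set
  \<open>F\<close>: on \<open>E \<inter> F\<close> the coefficient \<open>d\<close> is absorbed into
  the constant, on \<open>E - F\<close> its term vanishes. Keeping \<open>E\<close> and
  \<open>c\<close> free makes the induction work, so no common partition for all the sets has to be
  built.\<close>

lemma additive_simple_nonneg:
  fixes \<mu> :: "'a set \<Rightarrow> real" and s :: "(real \<times> 'a set) list"
  assumes alg: "algebra \<Omega> M" and add: "additive M \<mu>" and pos: "\<And>E. E \<in> M \<Longrightarrow> 0 \<le> \<mu> E"
    and "E \<in> M" and "snd ` set s \<subseteq> M"
    and "\<And>x. x \<in> E \<Longrightarrow> 0 \<le> c + (\<Sum>(d, F)\<leftarrow>s. d * indicator F x)"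
  shows "0 \<le> c * \<mu> E + (\<Sum>(d, F)\<leftarrow>s. d * \<mu> (E \<inter> F))"
  using assms(4-)
proof (induction s arbitrary: E c)
  case Nil
  \<comment> \<open>A point of \<open>E\<close> forces \<open>0 \<le> c\<close>. For empty
    \<open>E\<close> the pointwise bound says nothing, but then \<open>\<mu> E\<close> is 0.\<close>
  then show ?case
    using additive_empty[OF alg add] pos[of E] by (cases "E = {}") auto
next
  case (Cons p s)
  interpret algebra \<Omega> M by (fact alg)
  obtain d F where p: "p = (d, F)" by (cases p)
  have F: "F \<in> M" and s: "snd ` set s \<subseteq> M" using Cons.prems(2) p by auto
  have "0 \<le> (c + d) * \<mu> (E \<inter> F) + (\<Sum>(b, G)\<leftarrow>s. b * \<mu> (E \<inter> F \<inter> G))"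
  proof (rule Cons.IH[OF _ s])
    fix x assume "x \<in> E \<inter> F"
    then show "0 \<le> c + d + (\<Sum>(b, G)\<leftarrow>s. b * indicator G x)"
      using Cons.prems(3)[of x] p by simp
  qed (use F Cons.prems in auto)
  moreover have "0 \<le> c * \<mu> (E - F) + (\<Sum>(b, G)\<leftarrow>s. b * \<mu> ((E - F) \<inter> G))"
  proof (rule Cons.IH[OF _ s])
    fix x assume "x \<in> E - F"
    then show "0 \<le> c + (\<Sum>(b, G)\<leftarrow>s. b * indicator G x)"
      using Cons.prems(3)[of x] p by simp
  qed (use F Cons.prems in auto)
  \<comment> \<open>The sets of the tail are cut along \<open>F\<close> too, so that the two bounds
    add up to the bound on \<open>E\<close>.\<close>
  moreover have "(\<Sum>(b, G)\<leftarrow>s. b * \<mu> (E \<inter> G)) =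
      (\<Sum>(b, G)\<leftarrow>s. b * \<mu> (E \<inter> F \<inter> G)) + (\<Sum>(b, G)\<leftarrow>s. b * \<mu> ((E - F) \<inter> G))"
  proof -
    have "b * \<mu> (E \<inter> G) = b * \<mu> (E \<inter> F \<inter> G) + b * \<mu> ((E - F) \<inter> G)" if "(b, G) \<in> set s" for b G
    proof -
      have "G \<in> M" using s that by force
      then have "\<mu> (E \<inter> G) = \<mu> (E \<inter> G \<inter> F) + \<mu> (E \<inter> G - F)"
        using F Cons.prems by (intro additive_split[OF alg add]) auto
      moreover have "E \<inter> G \<inter> F = E \<inter> F \<inter> G" "E \<inter> G - F = (E - F) \<inter> G" by auto
      ultimately show ?thesis by (simp add: algebra_simps)
    qed
    then show ?thesis
      unfolding sum_list_addf[symmetric]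
      by (intro arg_cong[where f = sum_list] map_cong) auto
  qed
  moreover have "\<mu> E = \<mu> (E \<inter> F) + \<mu> (E - F)"
    using F Cons.prems by (intro additive_split[OF alg add]) auto
  ultimately show ?case by (simp add: p algebra_simps)
qed

section \<open>Strategy profiles and expected values of simple functions\<close>

lemma finite_players [simp]: "finite (players \<Gamma>)"
  by (simp add: players_def)

lemma fa_gameD:
  assumes "fa_game \<Gamma>" "i \<in> players \<Gamma>"
  shows "actions \<Gamma> i \<noteq> {}" "algebra (actions \<Gamma> i) (events \<Gamma> i)"
  using assms by (auto simp: fa_game_def)

lemma profilesD:
  assumes "\<kappa> \<in> profiles \<Gamma>" "i \<in> players \<Gamma>"
  shows "additive (events \<Gamma> i) (\<kappa> i)" "\<kappa> i (actions \<Gamma> i) = 1"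
    "E \<in> events \<Gamma> i \<Longrightarrow> 0 \<le> \<kappa> i E"
  using assms by (force simp: profiles_def strategies_def charges_def)+

lemma profiles_upd:
  assumes "\<kappa> \<in> profiles \<Gamma>" "i \<in> players \<Gamma>" "\<rho> \<in> strategies \<Gamma> i"
  shows "\<kappa>(i := \<rho>) \<in> profiles \<Gamma>"
  using assms by (auto simp: profiles_def PiE_def extensional_def)

text \<open>An empty family of rectangles, with any centre and radius 1, makes the whole of
  \<open>profiles G\<close> a subbasic set.\<close>

lemma topspace_profile_topology: "topspace (profile_topology G) = profiles G"
proof -
  have "{\<tau> \<in> profiles G. \<forall>R\<in>{}. \<bar>rect_charge G \<kappa> R - rect_charge G \<tau> R\<bar> < 1} = profiles G" for \<kappa>
    by simp
  then show ?thesis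
    unfolding profile_topology_def topology_generated_by_topspace
    by (fastforce intro: zero_less_one)
qed

text \<open>The product form allows the coordinates to be integrated one at a time.\<close>

lemma indicator_rect_set:
  assumes "a \<in> pure_profiles \<Gamma>"
  shows "indicator (rect_set \<Gamma> R) a = (\<Prod>i\<in>players \<Gamma>. indicator (R i) (a i) :: real)"
proof (cases "\<forall>i\<in>players \<Gamma>. a i \<in> R i")
  case True
  then show ?thesis
    using assms by (auto simp: rect_set_def pure_profiles_def indicator_def PiE_def)
next
  case False
  then obtain i where "i \<in> players \<Gamma>" "a i \<notin> R i" by blast
  then have "(\<Prod>i\<in>players \<Gamma>. indicator (R i) (a i) :: real) = 0"
    by (intro prod_zero bexI[of _ i]) auto
  moreover have "a \<notin> rect_set \<Gamma> R" using False by (auto simp: rect_set_def)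
  ultimately show ?thesis by simp
qed

lemma simple_integral_nonneg:
  assumes game: "fa_game \<Gamma>" and \<kappa>: "\<kappa> \<in> profiles \<Gamma>" and s: "s \<in> simple_reps \<Gamma>"
    and nn: "\<And>a. a \<in> pure_profiles \<Gamma> \<Longrightarrow> 0 \<le> simple_fun \<Gamma> s a"
  shows "0 \<le> simple_integral \<Gamma> \<kappa> s"
proof -
  let ?N = "players \<Gamma>"
  have Re: "R i \<in> events \<Gamma> i" if "(c, R) \<in> set s" "i \<in> ?N" for c R i
    using s that by (force simp: simple_reps_def rectangles_def)
  \<comment> \<open>Integrate out one coordinate after the other, keeping the remaining ones free.\<close>
  have partial: "\<forall>a\<in>pure_profiles \<Gamma>. 0 \<le> (\<Sum>(c, R)\<leftarrow>s.
      c * (\<Prod>i\<in>J. \<kappa> i (R i)) * (\<Prod>i\<in>?N - J. indicator (R i) (a i)))" if "J \<subseteq> ?N" for J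
  proof -
    have "finite J" using that finite_players finite_subset by blast
    then show ?thesis using that
    proof (induction J rule: finite_induct)
      case empty
      show ?case
        using nn by (simp add: simple_fun_def indicator_rect_set)
    next
      case (insert j J)
      show ?case
      proof
        fix a assume a: "a \<in> pure_profiles \<Gamma>"
        have j: "j \<in> ?N" using insert by simp
        interpret algebra "actions \<Gamma> j" "events \<Gamma> j" using fa_gameD(2)[OF game j] .
        let ?w = "\<lambda>c R. c * (\<Prod>i\<in>J. \<kappa> i (R i)) * (\<Prod>i\<in>?N - insert j J. indicator (R i) (a i))"
        let ?t = "map (\<lambda>(c, R). (?w c R, R j)) s"
        \<comment> \<open>Coordinate \<open>j\<close> enters each summand only through
          \<open>R j\<close>; everything else is the weight \<open>?w\<close>. The result for a
          single field is applied on the whole action set, with constant 0.\<close>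
        have "0 \<le> 0 * \<kappa> j (actions \<Gamma> j) + (\<Sum>(d, F)\<leftarrow>?t. d * \<kappa> j (actions \<Gamma> j \<inter> F))"
        proof (rule additive_simple_nonneg[OF fa_gameD(2)[OF game j] profilesD(1,3)[OF \<kappa> j]])
          fix x assume x: "x \<in> actions \<Gamma> j"
          then have "a(j := x) \<in> pure_profiles \<Gamma>"
            using a j by (auto simp: pure_profiles_def PiE_def extensional_def)
          then have "0 \<le> (\<Sum>(c, R)\<leftarrow>s. c * (\<Prod>i\<in>J. \<kappa> i (R i)) *
              (\<Prod>i\<in>?N - J. indicator (R i) ((a(j := x)) i)))"
            using insert by blast
          also have "\<dots> = 0 + (\<Sum>(d, F)\<leftarrow>?t. d * indicator F x)"
          proof -
            have "(\<Prod>i\<in>?N - J. indicator (R i) ((a(j := x)) i) :: real) =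
                indicator (R j) x * (\<Prod>i\<in>?N - insert j J. indicator (R i) (a i))" for R
            proof -
              have "?N - J = insert j (?N - insert j J)" using insert j by auto
              then have "(\<Prod>i\<in>?N - J. indicator (R i) ((a(j := x)) i) :: real) =
                  (\<Prod>i\<in>insert j (?N - insert j J). indicator (R i) ((a(j := x)) i))"
                by (rule arg_cong)
              also have "\<dots> = indicator (R j) x *
                  (\<Prod>i\<in>?N - insert j J. indicator (R i) ((a(j := x)) i))"
                by (subst prod.insert) auto
              also have "(\<Prod>i\<in>?N - insert j J. indicator (R i) ((a(j := x)) i) :: real) =
                  (\<Prod>i\<in>?N - insert j J. indicator (R i) (a i))"
                by (rule prod.cong) auto
              finally show ?thesis .
            qed
            then show ?thesis by (simp add: o_def split_def mult_ac)
          qed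
          finally show "0 \<le> 0 + (\<Sum>(d, F)\<leftarrow>?t. d * indicator F x)" .
        qed (use Re j in auto)
        also have "\<dots> = (\<Sum>(c, R)\<leftarrow>s. c * (\<Prod>i\<in>insert j J. \<kappa> i (R i)) *
            (\<Prod>i\<in>?N - insert j J. indicator (R i) (a i)))"
        proof -
          have "actions \<Gamma> j \<inter> R j = R j" if "(c, R) \<in> set s" for c R
            using Re[OF that j] sets_into_space by auto
          then show ?thesis
            using insert.hyps
            by (auto simp: o_def split_def mult_ac intro!: arg_cong[where f = sum_list] map_cong)
        qed
        finally show "0 \<le> (\<Sum>(c, R)\<leftarrow>s. c * (\<Prod>i\<in>insert j J. \<kappa> i (R i)) *
            (\<Prod>i\<in>?N - insert j J. indicator (R i) (a i)))" .
      qed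
    qed
  qed
  \<comment> \<open>Once all players are integrated out the sum no longer depends on
    \<open>a\<close>, but some \<open>a\<close> is required to read off the bound.\<close>
  have "pure_profiles \<Gamma> \<noteq> {}"
    using fa_gameD(1)[OF game] by (simp add: pure_profiles_def PiE_eq_empty_iff)
  then show ?thesis
    using partial[OF order_refl] by (auto simp: simple_integral_def rect_charge_def)
qed

text \<open>Appending the negated representation of \<open>s\<close> to \<open>t\<close> represents
  the difference, whose integral is nonnegative. In particular the integral depends only on the
  function and not on its representation.\<close>

lemma simple_integral_mono:
  assumes "fa_game \<Gamma>" "\<kappa> \<in> profiles \<Gamma>" "s \<in> simple_reps \<Gamma>" "t \<in> simple_reps \<Gamma>"
    and "\<And>a. a \<in> pure_profiles \<Gamma> \<Longrightarrow> simple_fun \<Gamma> s a \<le> simple_fun \<Gamma> t a"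
  shows "simple_integral \<Gamma> \<kappa> s \<le> simple_integral \<Gamma> \<kappa> t"
proof -
  let ?r = "t @ map (\<lambda>(c, R). (- c, R)) s"
  have "?r \<in> simple_reps \<Gamma>" using assms by (auto simp: simple_reps_def)
  moreover have "simple_fun \<Gamma> ?r a = simple_fun \<Gamma> t a - simple_fun \<Gamma> s a" for a
    by (simp add: simple_fun_def o_def split_def uminus_sum_list_map[symmetric, unfolded o_def])
  moreover have "simple_integral \<Gamma> \<kappa> ?r = simple_integral \<Gamma> \<kappa> t - simple_integral \<Gamma> \<kappa> s"
    by (simp add: simple_integral_def o_def split_def uminus_sum_list_map[symmetric, unfolded o_def])
  ultimately show ?thesis
    using simple_integral_nonneg[OF assms(1,2), of ?r] assms(5) by fastforce
qed

text \<open>The full rectangle has charge 1, so constants are simple and integrate to themselves.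
  This turns a uniform approximation into one from below or from above.\<close>

lemma simple_add_const:
  fixes c :: real and s \<Gamma>
  defines "t \<equiv> (c, \<lambda>i\<in>players \<Gamma>. actions \<Gamma> i) # s"
  assumes "fa_game \<Gamma>" "s \<in> simple_reps \<Gamma>"
  shows "t \<in> simple_reps \<Gamma>"
    and "a \<in> pure_profiles \<Gamma> \<Longrightarrow> simple_fun \<Gamma> t a = c + simple_fun \<Gamma> s a"
    and "\<kappa> \<in> profiles \<Gamma> \<Longrightarrow> simple_integral \<Gamma> \<kappa> t = c + simple_integral \<Gamma> \<kappa> s"
proof -
  have "actions \<Gamma> i \<in> events \<Gamma> i" if "i \<in> players \<Gamma>" for i
    using algebra.top[OF fa_gameD(2)[OF assms(2) that]] .
  then show "t \<in> simple_reps \<Gamma>"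
    using assms(3) by (auto simp: t_def simple_reps_def rectangles_def)
  show "simple_fun \<Gamma> t a = c + simple_fun \<Gamma> s a" if "a \<in> pure_profiles \<Gamma>"
    using that by (auto simp: t_def simple_fun_def rect_set_def pure_profiles_def indicator_def PiE_def)
  show "simple_integral \<Gamma> \<kappa> t = c + simple_integral \<Gamma> \<kappa> s" if "\<kappa> \<in> profiles \<Gamma>"
    using profilesD(2)[OF that] by (simp add: t_def simple_integral_def rect_charge_def)
qed

lemma simple_approximation:
  assumes "fa_game \<Gamma>" "i \<in> players \<Gamma>" "0 < \<epsilon>"
  obtains s where "s \<in> simple_reps \<Gamma>"
    "\<And>a. a \<in> pure_profiles \<Gamma> \<Longrightarrow> \<bar>simple_fun \<Gamma> s a - util \<Gamma> i a\<bar> < \<epsilon>"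
proof -
  obtain s where s: "\<And>k. s k \<in> simple_reps \<Gamma>"
    and lim: "uniform_limit (pure_profiles \<Gamma>) (\<lambda>k. simple_fun \<Gamma> (s k)) (util \<Gamma> i) sequentially"
    using assms(1,2) unfolding fa_game_def by blast
  obtain k where "\<forall>a\<in>pure_profiles \<Gamma>. dist (simple_fun \<Gamma> (s k) a) (util \<Gamma> i a) < \<epsilon>"
    using eventually_happens'[OF _ uniform_limitD[OF lim assms(3)]] by auto
  then show ?thesis using that[OF s] by (auto simp: dist_real_def)
qed

text \<open>Meant for comparing the lower sums of two games. The density assumption for a single
  \<epsilon> already makes \<open>L'\<close> nonempty and \<open>L\<close> bounded above, which the
  suprema of reals require.\<close>

lemma Sup_eq_of_dense_subset:
  fixes L L' :: "real set"
  assumes sub: "L' \<subseteq> L" and dense: "\<And>\<epsilon>. 0 < \<epsilon> \<Longrightarrow> \<exists>y\<in>L'. \<forall>x\<in>L. x \<le> y + \<epsilon>"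
  shows "Sup L = Sup L'"
proof (rule antisym)
  have ne: "L' \<noteq> {}" using dense[of 1] by auto
  have bdd: "bdd_above L" using dense[of 1] by (auto simp: bdd_above_def)
  show "Sup L' \<le> Sup L" by (rule cSup_subset_mono[OF ne bdd sub])
  show "Sup L \<le> Sup L'"
  proof (rule cSup_least)
    fix x assume x: "x \<in> L"
    show "x \<le> Sup L'"
    proof (rule field_le_epsilon)
      fix \<epsilon> :: real assume "0 < \<epsilon>"
      then obtain y where "y \<in> L'" "x \<le> y + \<epsilon>" using dense x by blast
      moreover have "y \<le> Sup L'"
        using \<open>y \<in> L'\<close> bdd_above_mono[OF bdd sub] by (rule cSup_upper)
      ultimately show "x \<le> Sup L' + \<epsilon>" by linarith
    qed
  qed (use ne sub in auto)
qed

section \<open>Lifting charges along surjections\<close>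

text \<open>Splitting along the members of \<open>D\<close> produces a charge with finite support.\<close>

lemma finitely_supported_charge:
  fixes \<nu> :: "'a set \<Rightarrow> real"
  assumes alg: "algebra \<Omega> M" and add: "additive M \<nu>" and pos: "\<And>E. E \<in> M \<Longrightarrow> 0 \<le> \<nu> E"
    and "finite D" "D \<subseteq> M" "E \<in> M"
  shows "\<exists>\<mu>. additive UNIV \<mu> \<and> (\<forall>X. 0 \<le> \<mu> X) \<and> (\<forall>X. \<mu> (X \<inter> E) = \<mu> X) \<and>
    \<mu> UNIV = \<nu> E \<and> (\<forall>F\<in>D. \<mu> F = \<nu> (E \<inter> F))"
  using assms(4-)
proof (induction D arbitrary: E rule: finite_induct)
  case (empty E)
  \<comment> \<open>The whole mass \<open>\<nu> E\<close> is put on one point of \<open>E\<close>;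
    an empty \<open>E\<close> has mass 0 and receives the zero charge.\<close>
  show ?case
  proof (cases "E = {}")
    case True
    then show ?thesis
      using additive_empty[OF alg add] by (intro exI[of _ "\<lambda>_. 0"]) (auto simp: additive_def)
  next
    case False
    then obtain x where "x \<in> E" by blast
    then show ?thesis
      using pos[OF empty(2)]
      by (intro exI[of _ "\<lambda>X. \<nu> E * indicator X x"]) (auto simp: additive_def indicator_def)
  qed
next
  case (insert F D E)
  interpret algebra \<Omega> M by (fact alg)
  have F: "F \<in> M" "E \<in> M" "D \<subseteq> M" using insert.prems by auto
  then have "E \<inter> F \<in> M" "E - F \<in> M" by auto
  \<comment> \<open>The witness will be the sum of the charges for the two pieces. The invariant
    \<open>\<mu> (X \<inter> E) = \<mu> X\<close> says that the mass sits on \<open>E\<close>; it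
    determines the value at the new set \<open>F\<close>.\<close>
  from insert.IH[OF F(3) this(1)] insert.IH[OF F(3) this(2)] obtain \<mu>1 \<mu>2 where
    1: "additive UNIV \<mu>1" "\<And>X. 0 \<le> \<mu>1 X" "\<And>X. \<mu>1 (X \<inter> (E \<inter> F)) = \<mu>1 X" "\<mu>1 UNIV = \<nu> (E \<inter> F)"
      "\<And>G. G \<in> D \<Longrightarrow> \<mu>1 G = \<nu> (E \<inter> F \<inter> G)" and
    2: "additive UNIV \<mu>2" "\<And>X. 0 \<le> \<mu>2 X" "\<And>X. \<mu>2 (X \<inter> (E - F)) = \<mu>2 X" "\<mu>2 UNIV = \<nu> (E - F)"
      "\<And>G. G \<in> D \<Longrightarrow> \<mu>2 G = \<nu> ((E - F) \<inter> G)" by blast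
  have "\<mu>1 (X \<inter> E) = \<mu>1 X" "\<mu>2 (X \<inter> E) = \<mu>2 X" for X
  proof -
    have "X \<inter> E \<inter> (E \<inter> F) = X \<inter> (E \<inter> F)" "X \<inter> E \<inter> (E - F) = X \<inter> (E - F)" by auto
    then show "\<mu>1 (X \<inter> E) = \<mu>1 X" "\<mu>2 (X \<inter> E) = \<mu>2 X"
      using 1(3) 2(3) by metis+
  qed
  \<comment> \<open>\<open>\<mu>1\<close> sits inside \<open>F\<close> and \<open>\<mu>2\<close>
    outside, so the sum gives \<open>F\<close> exactly \<open>\<nu> (E \<inter> F)\<close>.\<close>
  moreover have "\<mu>1 F = \<mu>1 UNIV" using 1(3)[of F] 1(3)[of UNIV] by (simp add: Int_ac)
  moreover have "\<mu>2 F = 0"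
  proof -
    have "F \<inter> (E - F) = {}" by auto
    then show ?thesis
      using 2(3)[of F] additive_empty[OF algebra_Pow[of UNIV], of \<mu>2] 2(1) by simp
  qed
  moreover have "\<nu> (E \<inter> G) = \<nu> (E \<inter> F \<inter> G) + \<nu> ((E - F) \<inter> G)" if "G \<in> D" for G
  proof -
    have "\<nu> (E \<inter> G) = \<nu> (E \<inter> G \<inter> F) + \<nu> (E \<inter> G - F)"
      using F that by (intro additive_split[OF alg add]) auto
    moreover have "E \<inter> G \<inter> F = E \<inter> F \<inter> G" "E \<inter> G - F = (E - F) \<inter> G" by auto
    ultimately show ?thesis by simp
  qed
  moreover have "\<nu> E = \<nu> (E \<inter> F) + \<nu> (E - F)"
    using F by (intro additive_split[OF alg add]) auto
  ultimately show ?case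
    using 1 2 by (intro exI[of _ "\<lambda>X. \<mu>1 X + \<mu>2 X"]) (auto simp: additive_def)
qed

text \<open>By Tychonoff's theorem the set functions with values in [0,1] form a compact space.
  Evaluations are continuous, so additivity and each condition \<open>\<mu> E = \<nu> E\<close> are
  closed; finitely many of them are met by \<open>finitely_supported_charge\<close>.\<close>

lemma charge_extension:
  fixes \<nu> :: "'a set \<Rightarrow> real"
  assumes alg: "algebra \<Omega> M" and add: "additive M \<nu>" and pos: "\<And>E. E \<in> M \<Longrightarrow> 0 \<le> \<nu> E"
    and one: "\<nu> \<Omega> = 1"
  obtains \<mu> where "additive UNIV \<mu>" "\<And>X. \<mu> X \<in> {0..1}" "\<And>E. E \<in> M \<Longrightarrow> \<mu> E = \<nu> E"
proof -
  interpret algebra \<Omega> M by (fact alg)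
  let ?K = "(\<Pi>\<^sub>E X\<in>UNIV. {0..1}) :: ('a set \<Rightarrow> real) set"
  have "compact ?K"
    using compactin_PiE[of "\<lambda>_. euclidean" UNIV "\<lambda>_::'a set. {0..1::real}"]
    by (simp add: euclidean_product_topology)
  moreover have "closed {\<mu> :: 'a set \<Rightarrow> real. additive UNIV \<mu>}"
    unfolding additive_def ball_UNIV
    by (intro closed_Collect_all closed_Collect_imp closed_Collect_eq) (auto intro!: continuous_intros)
  ultimately have "compact (?K \<inter> {\<mu>. additive UNIV \<mu>})" by (rule compact_Int_closed)
  moreover have "closed {\<mu> :: 'a set \<Rightarrow> real. \<mu> E = \<nu> E}" for E
    by (intro closed_Collect_eq) (auto intro!: continuous_intros)
  moreover have "?K \<inter> {\<mu>. additive UNIV \<mu>} \<inter> (\<Inter>E\<in>D. {\<mu>. \<mu> E = \<nu> E}) \<noteq> {}"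
    if D: "finite D" "D \<subseteq> M" for D
  proof -
    obtain \<mu> where \<mu>: "additive UNIV \<mu>" "\<And>X. 0 \<le> \<mu> X" "\<mu> UNIV = \<nu> \<Omega>"
      "\<And>F. F \<in> D \<Longrightarrow> \<mu> F = \<nu> (\<Omega> \<inter> F)"
      using finitely_supported_charge[OF alg add pos D top] by blast
    have "\<mu> F = \<nu> F" if "F \<in> D" for F
      using \<mu>(4)[OF that] D that sets_into_space by (metis Int_absorb1 subsetD)
    \<comment> \<open>The total mass is \<open>\<nu> \<Omega> = 1\<close>, and the complement of
      \<open>X\<close> has nonnegative mass.\<close>
    moreover have "\<mu> X \<le> 1" for X
      using additive_split[OF algebra_Pow[of UNIV], of \<mu> UNIV X] \<mu>(1,3) \<mu>(2)[of "UNIV - X"] one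
      by simp
    ultimately have "\<mu> \<in> ?K \<inter> {\<mu>. additive UNIV \<mu>} \<inter> (\<Inter>E\<in>D. {\<mu>. \<mu> E = \<nu> E})"
      using \<mu>(1,2) by auto
    then show ?thesis by blast
  qed
  ultimately have "?K \<inter> {\<mu>. additive UNIV \<mu>} \<inter> (\<Inter>E\<in>M. {\<mu>. \<mu> E = \<nu> E}) \<noteq> {}"
    by (rule compact_imp_fip_image)
  then obtain \<mu> where "\<mu> \<in> ?K" "additive UNIV \<mu>" "\<And>E. E \<in> M \<Longrightarrow> \<mu> E = \<nu> E" by blast
  then show ?thesis by (intro that[of \<mu>]) (auto simp: PiE_iff)
qed

section \<open>Image charges and their lifts\<close>

lemma push_charge_in_charges:
  assumes "algebra \<Omega> M" "algebra \<Omega>' M'" "f ` \<Omega> = \<Omega>'"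
    and "\<And>G. G \<in> M' \<Longrightarrow> f -` G \<inter> \<Omega> \<in> M" and "\<mu> \<in> charges \<Omega> M"
  shows "push_charge \<Omega> M' f \<mu> \<in> charges \<Omega>' M'"
proof -
  interpret algebra \<Omega> M by fact
  interpret B: algebra \<Omega>' M' by fact
  have "additive M' (push_charge \<Omega> M' f \<mu>)"
    unfolding additive_def
  proof (intro ballI impI)
    fix X Y assume XY: "X \<in> M'" "Y \<in> M'" "X \<inter> Y = {}"
    then have "\<mu> ((f -` X \<inter> \<Omega>) \<union> (f -` Y \<inter> \<Omega>)) = \<mu> (f -` X \<inter> \<Omega>) + \<mu> (f -` Y \<inter> \<Omega>)"
      using assms by (intro additiveD[of M]) (auto simp: charges_def)
    then show "push_charge \<Omega> M' f \<mu> (X \<union> Y) = push_charge \<Omega> M' f \<mu> X + push_charge \<Omega> M' f \<mu> Y"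
      using XY by (simp add: push_charge_def Int_Un_distrib2 B.Un)
  qed
  moreover have "f -` \<Omega>' \<inter> \<Omega> = \<Omega>" using assms(3) by auto
  ultimately show ?thesis
    using assms(4,5) by (auto simp: charges_def push_charge_def PiE_iff)
qed

text \<open>A right inverse \<open>g\<close> of \<open>f\<close> carries \<nu> back to
  \<open>\<Omega>\<close>, but \<open>g\<close> need not be measurable: preimages of sets in
  \<open>M\<close> may fall outside \<open>M'\<close>. Hence \<nu> is first extended to all
  sets.\<close>

lemma push_charge_surj:
  assumes "algebra \<Omega> M" "algebra \<Omega>' M'" "f ` \<Omega> = \<Omega>'"
    and "\<And>G. G \<in> M' \<Longrightarrow> f -` G \<inter> \<Omega> \<in> M" and "\<nu> \<in> charges \<Omega>' M'"
  obtains \<mu> where "\<mu> \<in> charges \<Omega> M" "push_charge \<Omega> M' f \<mu> = \<nu>"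
proof -
  interpret algebra \<Omega> M by fact
  interpret B: algebra \<Omega>' M' by fact
  obtain \<mu>' where \<mu>': "additive UNIV \<mu>'" "\<And>X. \<mu>' X \<in> {0..1}" "\<And>E. E \<in> M' \<Longrightarrow> \<mu>' E = \<nu> E"
  proof (rule charge_extension[OF assms(2), of \<nu>])
    show "0 \<le> \<nu> E" if "E \<in> M'" for E using assms(5) that by (force simp: charges_def)
  qed (use assms(5) in \<open>auto simp: charges_def\<close>)
  define g where "g = inv_into \<Omega> f"
  have g: "g y \<in> \<Omega>" "f (g y) = y" if "y \<in> \<Omega>'" for y
    using that assms(3) by (auto simp: g_def inv_into_into f_inv_into_f)
  define \<mu> where "\<mu> = (\<lambda>E\<in>M. \<mu>' (g -` E \<inter> \<Omega>'))"
  have "additive M \<mu>"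
    unfolding additive_def
  proof (intro ballI impI)
    fix X Y assume XY: "X \<in> M" "Y \<in> M" "X \<inter> Y = {}"
    then have "\<mu>' ((g -` X \<inter> \<Omega>') \<union> (g -` Y \<inter> \<Omega>')) = \<mu>' (g -` X \<inter> \<Omega>') + \<mu>' (g -` Y \<inter> \<Omega>')"
      using \<mu>'(1) by (intro additiveD[of UNIV]) auto
    then show "\<mu> (X \<union> Y) = \<mu> X + \<mu> Y"
      using XY by (simp add: \<mu>_def Int_Un_distrib2 Un)
  qed
  moreover have "g -` \<Omega> \<inter> \<Omega>' = \<Omega>'" using g by auto
  ultimately have "\<mu> \<in> charges \<Omega> M"
    using \<mu>'(2,3) assms(5) by (auto simp: charges_def \<mu>_def PiE_iff)
  moreover have "push_charge \<Omega> M' f \<mu> = \<nu>"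
  proof
    fix G
    show "push_charge \<Omega> M' f \<mu> G = \<nu> G"
    proof (cases "G \<in> M'")
      case True
      \<comment> \<open>Since \<open>f (g y) = y\<close> on \<open>\<Omega>'\<close>, pulling back
        along \<open>f\<close> and then \<open>g\<close> returns \<open>G\<close>, a set on which
        the extension agrees with \<nu>.\<close>
      then have "g -` (f -` G \<inter> \<Omega>) \<inter> \<Omega>' = G"
        using g B.sets_into_space by fastforce
      then show ?thesis
        using True assms(4) \<mu>'(3) by (simp add: push_charge_def \<mu>_def)
    next
      case False
      \<comment> \<open>Off \<open>M'\<close> both sides are \<open>undefined\<close>, charges being
        extensional.\<close>
      then show ?thesis
        using assms(5) by (auto simp: push_charge_def charges_def PiE_iff extensional_def)
    qed
  qed
  ultimately show ?thesis by (rule that)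
qed

section \<open>Payoff-preserving surjections of games\<close>

locale game_surjection =
  fixes \<Gamma> :: "'a game" and \<Gamma>' :: "'b game" and \<phi> :: "nat \<Rightarrow> 'a \<Rightarrow> 'b"
  assumes game: "fa_game \<Gamma>" and game': "fa_game \<Gamma>'"
    and num_players: "num_players \<Gamma>' = num_players \<Gamma>"
    and surj: "\<And>i. i \<in> players \<Gamma> \<Longrightarrow> \<phi> i ` actions \<Gamma> i = actions \<Gamma>' i"
    and meas: "\<And>i G. i \<in> players \<Gamma> \<Longrightarrow> G \<in> events \<Gamma>' i \<Longrightarrow> \<phi> i -` G \<inter> actions \<Gamma> i \<in> events \<Gamma> i"
    and util: "\<And>i a. i \<in> players \<Gamma> \<Longrightarrow> a \<in> pure_profiles \<Gamma> \<Longrightarrow>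
           util \<Gamma> i a = util \<Gamma>' i (pure_map \<Gamma> \<phi> a)"
begin

abbreviation push :: "'a profile \<Rightarrow> 'b profile" where
  "push \<equiv> push_profile \<Gamma> \<Gamma>' \<phi>"

definition pull_rect :: "(nat \<Rightarrow> 'b set) \<Rightarrow> nat \<Rightarrow> 'a set" where
  "pull_rect R = (\<lambda>i\<in>players \<Gamma>. \<phi> i -` R i \<inter> actions \<Gamma> i)"

text \<open>Represents the composition of a simple function with
  \<open>pure_map \<Gamma> \<phi>\<close>. That map acts coordinatewise, so preimages of rectangles
  are rectangles and the composition stays simple.\<close>

definition pull_rep :: "(real \<times> (nat \<Rightarrow> 'b set)) list \<Rightarrow> (real \<times> (nat \<Rightarrow> 'a set)) list" where
  "pull_rep s = map (\<lambda>(c, R). (c, pull_rect R)) s"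

lemma players_eq [simp]: "players \<Gamma>' = players \<Gamma>"
  by (simp add: players_def num_players)

lemma algebras:
  assumes "i \<in> players \<Gamma>"
  shows "algebra (actions \<Gamma> i) (events \<Gamma> i)" "algebra (actions \<Gamma>' i) (events \<Gamma>' i)"
  using assms fa_gameD[OF game] fa_gameD[OF game'] by auto

lemma pure_map_in: "a \<in> pure_profiles \<Gamma> \<Longrightarrow> pure_map \<Gamma> \<phi> a \<in> pure_profiles \<Gamma>'"
  using surj by (fastforce simp: pure_profiles_def pure_map_def)

lemma push_strategy:
  assumes "i \<in> players \<Gamma>" "\<rho> \<in> strategies \<Gamma> i"
  shows "push_charge (actions \<Gamma> i) (events \<Gamma>' i) (\<phi> i) \<rho> \<in> strategies \<Gamma>' i"
  unfolding strategies_def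
  by (rule push_charge_in_charges[OF algebras[OF assms(1)] surj meas])
    (use assms in \<open>auto simp: strategies_def\<close>)

lemma push_strategy_surj:
  assumes "i \<in> players \<Gamma>" "\<rho>' \<in> strategies \<Gamma>' i"
  obtains \<rho> where "\<rho> \<in> strategies \<Gamma> i" "push_charge (actions \<Gamma> i) (events \<Gamma>' i) (\<phi> i) \<rho> = \<rho>'"
  unfolding strategies_def
  by (rule push_charge_surj[OF algebras[OF assms(1)] surj meas, of \<rho>'])
    (use assms in \<open>auto simp: strategies_def\<close>)

lemma push_in: "\<kappa> \<in> profiles \<Gamma> \<Longrightarrow> push \<kappa> \<in> profiles \<Gamma>'"
  using push_strategy by (auto simp: profiles_def push_profile_def PiE_iff)

text \<open>Lifts are chosen player by player. This is how carriers and centres of subbasic open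
  sets of \<open>\<Gamma>'\<close> are brought back to \<open>\<Gamma>\<close>.\<close>

lemma push_surj:
  assumes "\<kappa>' \<in> profiles \<Gamma>'"
  obtains \<kappa> where "\<kappa> \<in> profiles \<Gamma>" "push \<kappa> = \<kappa>'"
proof -
  have "\<exists>\<rho>. \<rho> \<in> strategies \<Gamma> i \<and> push_charge (actions \<Gamma> i) (events \<Gamma>' i) (\<phi> i) \<rho> = \<kappa>' i"
    if "i \<in> players \<Gamma>" for i
  proof -
    have "\<kappa>' i \<in> strategies \<Gamma>' i" using assms that by (auto simp: profiles_def)
    then show ?thesis using push_strategy_surj[OF that] by blast
  qed
  then obtain h where h: "\<And>i. i \<in> players \<Gamma> \<Longrightarrow> h i \<in> strategies \<Gamma> i \<and>
      push_charge (actions \<Gamma> i) (events \<Gamma>' i) (\<phi> i) (h i) = \<kappa>' i" by metis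
  have "push (\<lambda>i\<in>players \<Gamma>. h i) = \<kappa>'"
    using h assms by (auto simp: push_profile_def profiles_def PiE_iff extensional_def fun_eq_iff)
  then show ?thesis using h by (intro that) (auto simp: profiles_def)
qed

lemma push_upd:
  assumes "i \<in> players \<Gamma>"
  shows "push (\<kappa>(i := \<rho>)) = (push \<kappa>)(i := push_charge (actions \<Gamma> i) (events \<Gamma>' i) (\<phi> i) \<rho>)"
  using assms by (auto simp: push_profile_def fun_eq_iff)

section \<open>Pulling back simple functions and comparing payoffs\<close>

lemma pull_rect_in: "R \<in> rectangles \<Gamma>' \<Longrightarrow> pull_rect R \<in> rectangles \<Gamma>"
  using meas by (auto simp: rectangles_def pull_rect_def PiE_iff)

lemma pull_rep_in: "s \<in> simple_reps \<Gamma>' \<Longrightarrow> pull_rep s \<in> simple_reps \<Gamma>"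
  using pull_rect_in by (fastforce simp: simple_reps_def pull_rep_def)

lemma rect_charge_push:
  assumes "R \<in> rectangles \<Gamma>'"
  shows "rect_charge \<Gamma>' (push \<kappa>) R = rect_charge \<Gamma> \<kappa> (pull_rect R)"
  using assms
  by (auto simp: rect_charge_def push_profile_def push_charge_def pull_rect_def rectangles_def
      intro!: prod.cong)

lemma simple_integral_push:
  assumes "s \<in> simple_reps \<Gamma>'"
  shows "simple_integral \<Gamma>' (push \<kappa>) s = simple_integral \<Gamma> \<kappa> (pull_rep s)"
  unfolding simple_integral_def pull_rep_def map_map
  by (intro arg_cong[where f = sum_list] map_cong)
    (use assms in \<open>auto simp: simple_reps_def rect_charge_push\<close>)

lemma simple_fun_pull:
  assumes "a \<in> pure_profiles \<Gamma>"
  shows "simple_fun \<Gamma> (pull_rep s) a = simple_fun \<Gamma>' s (pure_map \<Gamma> \<phi> a)"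
proof -
  have "a \<in> rect_set \<Gamma> (pull_rect R) \<longleftrightarrow> pure_map \<Gamma> \<phi> a \<in> rect_set \<Gamma>' R" for R
    using assms by (auto simp: rect_set_def pull_rect_def pure_map_def pure_profiles_def PiE_iff)
  then have "indicator (rect_set \<Gamma> (pull_rect R)) a =
      (indicator (rect_set \<Gamma>' R) (pure_map \<Gamma> \<phi> a) :: real)" for R
    by (simp add: indicator_def)
  then show ?thesis
    by (simp add: simple_fun_def pull_rep_def o_def split_def)
qed

text \<open>Pulling back makes every lower sum of \<open>\<Gamma>'\<close> a lower sum of
  \<open>\<Gamma>\<close>. The fields of \<open>\<Gamma>\<close> may be finer and yield further
  lower sums, but uniform approximation in \<open>\<Gamma>'\<close> shows that these gain at most
  \<epsilon>.\<close>

lemma payoff_push: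
  assumes i: "i \<in> players \<Gamma>" and \<kappa>: "\<kappa> \<in> profiles \<Gamma>"
  shows "payoff \<Gamma>' i (push \<kappa>) = payoff \<Gamma> i \<kappa>"
  unfolding payoff_def
proof (rule Sup_eq_of_dense_subset[symmetric])
  let ?L = "{simple_integral \<Gamma> \<kappa> s | s.
       s \<in> simple_reps \<Gamma> \<and> (\<forall>a\<in>pure_profiles \<Gamma>. simple_fun \<Gamma> s a \<le> util \<Gamma> i a)}"
  let ?L' = "{simple_integral \<Gamma>' (push \<kappa>) s | s.
       s \<in> simple_reps \<Gamma>' \<and> (\<forall>a\<in>pure_profiles \<Gamma>'. simple_fun \<Gamma>' s a \<le> util \<Gamma>' i a)}"
  show "?L' \<subseteq> ?L"
  proof clarify
    fix s assume s: "s \<in> simple_reps \<Gamma>'"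
      "\<forall>a\<in>pure_profiles \<Gamma>'. simple_fun \<Gamma>' s a \<le> util \<Gamma>' i a"
    then have "\<forall>a\<in>pure_profiles \<Gamma>. simple_fun \<Gamma> (pull_rep s) a \<le> util \<Gamma> i a"
      using util[OF i] pure_map_in by (simp add: simple_fun_pull)
    then show "\<exists>t. simple_integral \<Gamma>' (push \<kappa>) s = simple_integral \<Gamma> \<kappa> t \<and>
       t \<in> simple_reps \<Gamma> \<and> (\<forall>a\<in>pure_profiles \<Gamma>. simple_fun \<Gamma> t a \<le> util \<Gamma> i a)"
      using s(1) simple_integral_push pull_rep_in by blast
  qed
  fix \<epsilon> :: real assume \<epsilon>: "0 < \<epsilon>"
  obtain r where r: "r \<in> simple_reps \<Gamma>'"
    and approx: "\<And>a. a \<in> pure_profiles \<Gamma>' \<Longrightarrow> \<bar>simple_fun \<Gamma>' r a - util \<Gamma>' i a\<bar> < \<epsilon> / 2"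
    using simple_approximation[OF game', of i "\<epsilon> / 2"] i \<epsilon> by auto
  \<comment> \<open>Shifting \<open>r\<close> by half of \<epsilon> either way encloses the utility,
    and the integrals of \<open>lo\<close> and \<open>hi\<close> differ by exactly
    \<epsilon>.\<close>
  define lo where "lo = (- \<epsilon> / 2, \<lambda>i\<in>players \<Gamma>'. actions \<Gamma>' i) # r"
  define hi where "hi = (\<epsilon> / 2, \<lambda>i\<in>players \<Gamma>'. actions \<Gamma>' i) # r"
  note lo = simple_add_const[OF game' r, where c = "- \<epsilon> / 2", folded lo_def]
  note hi = simple_add_const[OF game' r, where c = "\<epsilon> / 2", folded hi_def]
  have "\<forall>a\<in>pure_profiles \<Gamma>'. simple_fun \<Gamma>' lo a \<le> util \<Gamma>' i a"
  proof
    fix a assume "a \<in> pure_profiles \<Gamma>'"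
    then show "simple_fun \<Gamma>' lo a \<le> util \<Gamma>' i a" using approx[of a] lo(2)[of a] by linarith
  qed
  then have "simple_integral \<Gamma>' (push \<kappa>) lo \<in> ?L'" using lo(1) by blast
  moreover have "x \<le> simple_integral \<Gamma>' (push \<kappa>) lo + \<epsilon>" if x: "x \<in> ?L" for x
  proof -
    obtain s where s: "x = simple_integral \<Gamma> \<kappa> s" "s \<in> simple_reps \<Gamma>"
      "\<forall>a\<in>pure_profiles \<Gamma>. simple_fun \<Gamma> s a \<le> util \<Gamma> i a" using x by blast
    \<comment> \<open>The comparison takes place in \<open>\<Gamma>\<close>, because
      \<open>s\<close> need not be constant on the fibres of \<phi> and so need not come from
      \<open>\<Gamma>'\<close>.\<close>
    have "simple_integral \<Gamma> \<kappa> s \<le> simple_integral \<Gamma> \<kappa> (pull_rep hi)"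
    proof (rule simple_integral_mono[OF game \<kappa> s(2) pull_rep_in[OF hi(1)]])
      fix a assume a: "a \<in> pure_profiles \<Gamma>"
      show "simple_fun \<Gamma> s a \<le> simple_fun \<Gamma> (pull_rep hi) a"
        using bspec[OF s(3) a] util[OF i a] approx[OF pure_map_in[OF a]] hi(2)[OF pure_map_in[OF a]]
        unfolding simple_fun_pull[OF a] by linarith
    qed
    also have "\<dots> = simple_integral \<Gamma>' (push \<kappa>) lo + \<epsilon>"
      using hi(3)[OF push_in[OF \<kappa>]] lo(3)[OF push_in[OF \<kappa>]] simple_integral_push[OF hi(1), of \<kappa>]
      by simp
    finally show ?thesis using s(1) by simp
  qed
  ultimately show "\<exists>y\<in>?L'. \<forall>x\<in>?L. x \<le> y + \<epsilon>" by blast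
qed

section \<open>Transport of best responses, completely mixed nets and limits\<close>

lemma best_response_push:
  assumes \<sigma>: "\<sigma> \<in> profiles \<Gamma>" and br: "best_response \<Gamma> \<tau> \<sigma>"
  shows "best_response \<Gamma>' (push \<tau>) (push \<sigma>)"
proof -
  have \<tau>: "\<tau> \<in> profiles \<Gamma>" using br by (simp add: best_response_def)
  have "payoff \<Gamma>' i ((push \<sigma>)(i := \<rho>')) \<le> payoff \<Gamma>' i ((push \<sigma>)(i := push \<tau> i))"
    if i: "i \<in> players \<Gamma>" and \<rho>': "\<rho>' \<in> strategies \<Gamma>' i" for i \<rho>'
  proof -
    \<comment> \<open>The deviation is lifted to \<open>\<Gamma>\<close>, where it earns the same
      payoff and cannot beat \<open>\<tau> i\<close>.\<close>
    obtain \<rho> where \<rho>: "\<rho> \<in> strategies \<Gamma> i"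
      "push_charge (actions \<Gamma> i) (events \<Gamma>' i) (\<phi> i) \<rho> = \<rho>'"
      using push_strategy_surj[OF i \<rho>'] .
    have br_i: "\<tau> i \<in> strategies \<Gamma> i" "payoff \<Gamma> i (\<sigma>(i := \<rho>)) \<le> payoff \<Gamma> i (\<sigma>(i := \<tau> i))"
      using br i \<rho>(1) by (auto simp: best_response_def best_response_for_def)
    have "(push \<sigma>)(i := \<rho>') = push (\<sigma>(i := \<rho>))"
      using push_upd[OF i] \<rho>(2) by simp
    moreover have "(push \<sigma>)(i := push \<tau> i) = push (\<sigma>(i := \<tau> i))"
      using push_upd[OF i] i by (simp add: push_profile_def)
    ultimately show ?thesis
      using br_i payoff_push[OF i profiles_upd[OF \<sigma> i]] \<rho>(1) by simp
  qed
  then show ?thesis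
    using push_in[OF \<tau>] by (auto simp: best_response_def best_response_for_def profiles_def)
qed

text \<open>A family of events of \<open>\<Gamma>'\<close> lies in the carrier of an image profile
  exactly when its preimage lies in the carrier of the original one.\<close>

lemma carrier_of_push:
  assumes "carrier_of \<Gamma> \<tau> \<subseteq> carrier_of \<Gamma> \<sigma>"
  shows "carrier_of \<Gamma>' (push \<tau>) \<subseteq> carrier_of \<Gamma>' (push \<sigma>)"
proof
  fix E assume E: "E \<in> carrier_of \<Gamma>' (push \<tau>)"
  then have "pull_rect E \<in> carrier_of \<Gamma> \<tau>"
    using meas by (auto simp: carrier_of_def pull_rect_def push_profile_def push_charge_def PiE_iff)
  then have "pull_rect E \<in> carrier_of \<Gamma> \<sigma>" using assms by blast
  then show "E \<in> carrier_of \<Gamma>' (push \<sigma>)"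
    using E by (auto simp: carrier_of_def pull_rect_def push_profile_def push_charge_def PiE_iff)
qed

text \<open>Each carrier of \<open>\<Gamma>'\<close> belongs to the image of some \<tau>, and an
  index that works for the carrier of \<tau> works for it as well.\<close>

lemma completely_mixed_push:
  assumes "completely_mixed \<Gamma> I le s"
  shows "completely_mixed \<Gamma>' I le (\<lambda>\<alpha>. push (s \<alpha>))"
  unfolding completely_mixed_def
proof (intro conjI ballI)
  show "push (s \<alpha>) \<in> profiles \<Gamma>'" if "\<alpha> \<in> I" for \<alpha>
    using assms that push_in by (simp add: completely_mixed_def)
  fix C assume "C \<in> carriers \<Gamma>'"
  then obtain \<tau> where \<tau>: "\<tau> \<in> profiles \<Gamma>" "C = carrier_of \<Gamma>' (push \<tau>)"
    using push_surj unfolding carriers_def by (metis imageE)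
  then have "carrier_of \<Gamma> \<tau> \<in> carriers \<Gamma>" by (simp add: carriers_def)
  then obtain \<alpha> where "\<alpha> \<in> I" "\<forall>\<beta>\<in>I. le \<alpha> \<beta> \<longrightarrow> carrier_of \<Gamma> \<tau> \<subseteq> carrier_of \<Gamma> (s \<beta>)"
    using assms unfolding completely_mixed_def by blast
  then show "\<exists>\<alpha>\<in>I. \<forall>\<beta>\<in>I. le \<alpha> \<beta> \<longrightarrow> C \<subseteq> carrier_of \<Gamma>' (push (s \<beta>))"
    using carrier_of_push \<tau>(2) by blast
qed

text \<open>As \<open>push\<close> is surjective, the centre of a subbasic open set of \<open>\<Gamma>'\<close> can be lifted, and the
  preimage of that set is again subbasic.\<close>

lemma continuous_map_push:
  "continuous_map (profile_topology \<Gamma>) (profile_topology \<Gamma>') push"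
proof -
  let ?S = "{{\<tau> \<in> profiles \<Gamma>'. \<forall>R\<in>\<R>. \<bar>rect_charge \<Gamma>' \<kappa> R - rect_charge \<Gamma>' \<tau> R\<bar> < \<epsilon>} | \<kappa> \<epsilon> \<R>.
       \<kappa> \<in> profiles \<Gamma>' \<and> 0 < \<epsilon> \<and> finite \<R> \<and> \<R> \<subseteq> rectangles \<Gamma>'}"
  have "continuous_map (profile_topology \<Gamma>) (topology_generated_by ?S) push"
  proof (rule continuous_on_generated_topo)
    fix U assume "U \<in> ?S"
    then obtain \<kappa>' \<epsilon> \<R> where
      U: "U = {\<tau> \<in> profiles \<Gamma>'. \<forall>R\<in>\<R>. \<bar>rect_charge \<Gamma>' \<kappa>' R - rect_charge \<Gamma>' \<tau> R\<bar> < \<epsilon>}"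
      and *: "\<kappa>' \<in> profiles \<Gamma>'" "0 < \<epsilon>" "finite \<R>" "\<R> \<subseteq> rectangles \<Gamma>'" by blast
    obtain \<kappa> where \<kappa>: "\<kappa> \<in> profiles \<Gamma>" "push \<kappa> = \<kappa>'" using push_surj[OF *(1)] .
    have "push -` U \<inter> topspace (profile_topology \<Gamma>) = {\<tau> \<in> profiles \<Gamma>.
        \<forall>R\<in>pull_rect ` \<R>. \<bar>rect_charge \<Gamma> \<kappa> R - rect_charge \<Gamma> \<tau> R\<bar> < \<epsilon>}"
      using *(4) push_in rect_charge_push
      by (auto simp: U \<kappa>(2)[symmetric] topspace_profile_topology subset_iff)
    moreover have "openin (profile_topology \<Gamma>) \<dots>"
      unfolding profile_topology_def
    proof (rule topology_generated_by_Basis, rule CollectI, intro exI conjI)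
      show "pull_rect ` \<R> \<subseteq> rectangles \<Gamma>" using *(4) pull_rect_in by blast
    qed (use * \<kappa> in auto)
    ultimately show "openin (profile_topology \<Gamma>) (push -` U \<inter> topspace (profile_topology \<Gamma>))"
      by simp
  next
    \<comment> \<open>Continuity into a generated topology also asks that the generating sets cover
      the image.\<close>
    have "\<Union>?S = profiles \<Gamma>'"
      using topspace_profile_topology[of \<Gamma>']
      unfolding profile_topology_def topology_generated_by_topspace .
    then show "push ` topspace (profile_topology \<Gamma>) \<subseteq> \<Union>?S"
      using push_in by (simp add: topspace_profile_topology image_subset_iff)
  qed
  then show ?thesis unfolding profile_topology_def[of \<Gamma>'] .
qed

lemma perfect_push:
  assumes "perfect \<Gamma> \<kappa>"
  shows "perfect \<Gamma>' (push \<kappa>)"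
proof -
  obtain I :: "('a profile \<times> 'a profile) net_index set" and le s k where
    \<kappa>: "\<kappa> \<in> profiles \<Gamma>" and dir: "directed_set I le" and cm: "completely_mixed \<Gamma> I le s"
    and k: "\<forall>\<alpha>\<in>I. k \<alpha> \<in> profiles \<Gamma>"
    and lim: "limitin (profile_topology \<Gamma>) s \<kappa> (net_filter I le)"
      "limitin (profile_topology \<Gamma>) k \<kappa> (net_filter I le)"
    and br: "\<forall>\<alpha>\<in>I. best_response \<Gamma> (k \<alpha>) (s \<alpha>)"
    using assms unfolding perfect_def perfect_via_def by blast
  \<comment> \<open>The directed set is kept; only the values of the two nets are pushed
    forward.\<close>
  have "perfect_via I le \<Gamma>' (push \<kappa>)"
    unfolding perfect_via_def
  proof (intro conjI exI)
    show "completely_mixed \<Gamma>' I le (\<lambda>\<alpha>. push (s \<alpha>))" by (rule completely_mixed_push[OF cm])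
    show "\<forall>\<alpha>\<in>I. push (k \<alpha>) \<in> profiles \<Gamma>'" using k push_in by blast
    show "limitin (profile_topology \<Gamma>') (\<lambda>\<alpha>. push (s \<alpha>)) (push \<kappa>) (net_filter I le)"
      "limitin (profile_topology \<Gamma>') (\<lambda>\<alpha>. push (k \<alpha>)) (push \<kappa>) (net_filter I le)"
      using lim[THEN continuous_map_limit[OF continuous_map_push]] by (simp_all add: o_def)
    show "\<forall>\<alpha>\<in>I. best_response \<Gamma>' (push (k \<alpha>)) (push (s \<alpha>))"
      using br cm best_response_push by (simp add: completely_mixed_def)
  qed (rule dir)
  \<comment> \<open>The index type of \<open>I\<close> is built from profiles of
    \<open>\<Gamma>\<close>, whereas \<open>perfect\<close> for \<open>\<Gamma>'\<close> asks for
    one built from profiles of \<open>\<Gamma>'\<close>; \<open>perfect_viaD\<close> reindexes the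
    nets.\<close>
  then show ?thesis using perfect_viaD push_in[OF \<kappa>] by blast
qed

lemma nash_equilibrium_push: "nash_equilibrium \<Gamma> \<kappa> \<Longrightarrow> nash_equilibrium \<Gamma>' (push \<kappa>)"
  using push_in best_response_push by (auto simp: nash_equilibrium_def)

end

theorem theorem27:
  fixes \<Gamma> :: "'a game" and \<Gamma>' :: "'b game" and \<phi> :: "nat \<Rightarrow> 'a \<Rightarrow> 'b" and \<kappa> :: "'a profile"
  assumes "fa_game \<Gamma>" and "fa_game \<Gamma>'"
    and "num_players \<Gamma>' = num_players \<Gamma>"
    and "\<And>i. i \<in> players \<Gamma> \<Longrightarrow> \<phi> i ` actions \<Gamma> i = actions \<Gamma>' i"
    and "\<And>i G. i \<in> players \<Gamma> \<Longrightarrow> G \<in> events \<Gamma>' i \<Longrightarrow> \<phi> i -` G \<inter> actions \<Gamma> i \<in> events \<Gamma> i"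
    and "\<And>i a. i \<in> players \<Gamma> \<Longrightarrow> a \<in> pure_profiles \<Gamma> \<Longrightarrow>
           util \<Gamma> i a = util \<Gamma>' i (pure_map \<Gamma> \<phi> a)"
    and "\<kappa> \<in> profiles \<Gamma>"
    and "perfect_equilibrium \<Gamma> \<kappa>"
  shows "perfect_equilibrium \<Gamma>' (push_profile \<Gamma> \<Gamma>' \<phi> \<kappa>)"
proof -
  interpret game_surjection \<Gamma> \<Gamma>' \<phi>
    using assms(1-6) by unfold_locales
  show ?thesis
    using assms(8) nash_equilibrium_push perfect_push by (simp add: perfect_equilibrium_def)
qed

end
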